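(* There exists a finite simple undirected graph $G$ such that $c(D) < c(G)$ for every strongly connected orientation $D$ of $G$.
   Context: All graphs are finite. An oriented graph is a directed graph without loops and without parallel or opposite arcs, i.e. a simple undirected graph each of whose edges has been assigned one direction; it is called an orientation of that underlying undirected graph. Game of cops and robbers with $k$ cops on a graph or digraph: first each of the $k$ cops chooses a starting vertex (several cops may share a vertex), then the robber chooses a starting vertex. The game proceeds in rounds: in each round every cop either stays in place or moves to an adjacent vertex, after which the robber either stays in place or moves to an adjacent vertex. In an undirected graph agents move along edges; in a digraph an agent at $u$ may move to $v$ only if $(u,v)$ is an arc. All positions are known to everyone. The cops win if after finitely many rounds some cop occupies the same vertex as the robber; the robber wins if he avoids this forever. The cop number $c(G)$ (or $c(D)$) is the least $k$ for which $k$ cops have a winning strategy. *)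

theory Defs
  imports "Graph_Theory.Digraph_Component"
begin

text \<open>
  Following the convention of the \<open>Graph_Theory\<close> library, a finite simple undirected graph is
  a \<open>pair_graph\<close>, i.e. a finite loopless symmetric digraph whose edges are pairs of opposite arcs.
  Moving along arcs of that digraph is moving along edges of the undirected graph, so that one
  definition of the game serves both for graphs and for digraphs.
\<close>

definition oriented_graph :: "'a pair_pre_digraph \<Rightarrow> bool" where
  "oriented_graph D \<longleftrightarrow> pair_digraph D \<and> asym (parcs D)"

definition orientation_of :: "'a pair_pre_digraph \<Rightarrow> 'a pair_pre_digraph \<Rightarrow> bool" where
  "orientation_of D G \<longleftrightarrow> oriented_graph D \<and> mk_symmetric (with_proj D) = G"

definition may_move :: "('a, 'b) pre_digraph \<Rightarrow> 'a \<Rightarrow> 'a \<Rightarrow> bool" where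
  "may_move D u v \<longleftrightarrow> u = v \<or> u \<rightarrow>\<^bsub>D\<^esub> v"

text \<open>\<open>r n\<close> is the position of the robber after his initial choice and \<open>n\<close> moves.\<close>

definition robber_play :: "('a, 'b) pre_digraph \<Rightarrow> (nat \<Rightarrow> 'a) \<Rightarrow> bool" where
  "robber_play D r \<longleftrightarrow> r 0 \<in> verts D \<and> (\<forall>n. may_move D (r n) (r (Suc n)))"

text \<open>
  The value \<open>\<sigma> [r 0, \<dots>, r (n - 1)] i\<close> of a strategy \<open>\<sigma>\<close> is the position of cop \<open>i\<close> after his
  initial choice and \<open>n\<close> moves, when the positions of the robber up to then were
  \<open>r 0, \<dots>, r (n - 1)\<close>; in particular \<open>\<sigma> []\<close> is the initial placement. The robber's history
  is the full information available to the cops, as it and \<open>\<sigma>\<close> determine all earlier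
  positions of the cops.
\<close>

definition cop_strategy ::
    "('a, 'b) pre_digraph \<Rightarrow> nat \<Rightarrow> ('a list \<Rightarrow> nat \<Rightarrow> 'a) \<Rightarrow> bool" where
  "cop_strategy D k \<sigma> \<longleftrightarrow>
     (\<forall>i<k. \<sigma> [] i \<in> verts D) \<and>
     (\<forall>r. robber_play D r \<longrightarrow>
       (\<forall>n. \<forall>i<k. may_move D (\<sigma> (map r [0..<n]) i) (\<sigma> (map r [0..<Suc n]) i)))"

text \<open>
  The two disjuncts are capture after a choice of position by the robber and capture by a move of
  a cop. Play is continued formally after a capture.
\<close>

definition captured :: "nat \<Rightarrow> ('a list \<Rightarrow> nat \<Rightarrow> 'a) \<Rightarrow> (nat \<Rightarrow> 'a) \<Rightarrow> bool" where
  "captured k \<sigma> r \<longleftrightarrow>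
     (\<exists>n. \<exists>i<k. \<sigma> (map r [0..<n]) i = r n \<or> \<sigma> (map r [0..<Suc n]) i = r n)"

definition cops_win :: "('a, 'b) pre_digraph \<Rightarrow> nat \<Rightarrow> bool" where
  "cops_win D k \<longleftrightarrow>
     (\<exists>\<sigma>. cop_strategy D k \<sigma> \<and> (\<forall>r. robber_play D r \<longrightarrow> captured k \<sigma> r))"

definition cop_number :: "('a, 'b) pre_digraph \<Rightarrow> nat" where
  "cop_number D = (LEAST k. cops_win D k)"

end

theory Submission
  imports Defs
begin

text \<open>
  The graph is the Petersen graph. It has girth 5 and all degrees are 3, so a cop away from the
  robber covers at most one of the robber's three neighbours, and two cops never catch him.

  Up to symmetry each strong orientation contains one of two partial orientations, with 11 and 12
  arcs, on which two cops win even if they may not use the other edges and the robber may use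
  these in both directions. Both were found by computer search. That every strong orientation
  contains one of them is a case distinction in which the branches that do not are closed by
  directed cuts. Symmetry keeps it short: a directed path of length 3 is found first, then a
  directed 5-cycle, then one of the two partial orientations.
\<close>

section \<open>The game\<close>

lemma verts_if_may_move:
  assumes "wf_digraph D" "may_move D u v" "u \<in> verts D"
  shows "v \<in> verts D"
  using assms by (auto simp: may_move_def dest: wf_digraph.adj_in_verts(2))

lemma robber_play_in_verts:
  assumes "wf_digraph D" "robber_play D r"
  shows "r n \<in> verts D"
  using assms by (induction n) (auto simp: robber_play_def intro: verts_if_may_move)

section \<open>Positions won by the cops in a bounded number of moves\<close>

definition caught :: "nat \<Rightarrow> (nat \<Rightarrow> 'a) \<Rightarrow> 'a \<Rightarrow> bool" where
  "caught k c x \<longleftrightarrow> (\<exists>i<k. c i = x)"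

definition cops_move :: "('a, 'b) pre_digraph \<Rightarrow> nat \<Rightarrow> (nat \<Rightarrow> 'a) \<Rightarrow> (nat \<Rightarrow> 'a) \<Rightarrow> bool" where
  "cops_move D k c c' \<longleftrightarrow> (\<forall>i<k. may_move D (c i) (c' i))"

text \<open>It is the cops' turn, and \<open>m\<close> counts only their moves.\<close>

primrec wins_within ::
    "('a, 'b) pre_digraph \<Rightarrow> nat \<Rightarrow> nat \<Rightarrow> (nat \<Rightarrow> 'a) \<Rightarrow> 'a \<Rightarrow> bool" where
  "wins_within D k 0 c x \<longleftrightarrow> caught k c x"
| "wins_within D k (Suc m) c x \<longleftrightarrow> caught k c x \<or> (\<exists>c'. cops_move D k c c' \<and>
     (caught k c' x \<or> (\<forall>y. may_move D x y \<longrightarrow> wins_within D k m c' y)))"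

lemma wins_within_Suc: "wins_within D k m c x \<Longrightarrow> wins_within D k (Suc m) c x"
  by (induction m arbitrary: c x) (simp, (metis wins_within.simps(2)))

lemma wins_within_mono: "m \<le> n \<Longrightarrow> wins_within D k m c x \<Longrightarrow> wins_within D k n c x"
  by (induction rule: dec_induct) (simp_all only: wins_within_Suc)

text \<open>The backward recursion of \<open>wins_within\<close> is turned into a strategy on
  histories: each reply is a chosen witness that lowers the bound by one. One bound \<open>m\<close>
  serves all starting vertices of the robber, so the strategy can carry a countdown.\<close>

lemma cops_win_if_wins_within:
  assumes start: "\<And>i. i < k \<Longrightarrow> c i \<in> verts D"
    and win: "\<And>x. x \<in> verts D \<Longrightarrow> wins_within D k m c x"
  shows "cops_win D k"
proof -
  \<comment> \<open>\<open>good m c x\<close> describes the witnesses \<open>c'\<close> for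
    \<open>wins_within D k (Suc m) c x\<close> when the robber is still free: after the move,
    \<open>m\<close> more moves suffice.\<close>
  define good where "good m c x c' \<longleftrightarrow> cops_move D k c c' \<and>
    (caught k c' x \<or> (\<forall>y. may_move D x y \<longrightarrow> wins_within D k m c' y))" for m c x c'
  \<comment> \<open>Staying put is the default, so that the reply is a legal move even from
    positions that are not won.\<close>
  define respond where
    "respond m c x = (if \<exists>c'. good m c x c' then SOME c'. good m c x c' else c)" for m c x
  \<comment> \<open>Folding over the robber's history keeps the number of cop moves left and the
    cops' positions. The counter is lowered before the reply, and stays at 0 once it gets
    there.\<close>
  define state where
    "state = foldl (\<lambda>(m, c) x. (m - 1, respond (m - 1) c x)) (m, c)"
  define \<sigma> where "\<sigma> h = snd (state h)" for h
  have respond_good: "good m c x (respond m c x)" if "good m c x c'" for m c x c'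
    unfolding respond_def using someI[of "good m c x", OF that] that by auto
  have respond_move: "cops_move D k c (respond m c x)" for m c x
  proof (cases "\<exists>c'. good m c x c'")
    case True
    then show ?thesis using respond_good good_def by blast
  next
    case False
    then show ?thesis by (simp add: respond_def cops_move_def may_move_def)
  qed
  have fst_state: "fst (state h) = m - length h" for h
    by (induction h rule: rev_induct) (auto simp: state_def split: prod.split)
  have \<sigma>_snoc: "\<sigma> (h @ [x]) = respond (m - Suc (length h)) (\<sigma> h) x" for h x
    using fst_state[of h] by (auto simp: \<sigma>_def state_def split: prod.split)
  have "cop_strategy D k \<sigma>"
    using start respond_move
    by (auto simp: cop_strategy_def \<sigma>_snoc cops_move_def) (simp add: \<sigma>_def state_def)
  moreover have "captured k \<sigma> r" if r: "robber_play D r" for r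
  proof (rule ccontr)
    assume free: "\<not> captured k \<sigma> r"
    \<comment> \<open>Invariant against an uncaught robber; at \<open>n = m\<close> it says that he
      is caught.\<close>
    have "wins_within D k (m - n) (\<sigma> (map r [0..<n])) (r n)" if "n \<le> m" for n
      using that
    proof (induction n)
      case 0
      then show ?case using win r by (simp add: \<sigma>_def state_def robber_play_def)
    next
      case (Suc n)
      let ?c = "\<sigma> (map r [0..<n])"
      have "wins_within D k (Suc (m - Suc n)) ?c (r n)"
        using Suc by (simp add: Suc_diff_Suc)
      moreover have "\<not> caught k ?c (r n)"
        using free unfolding captured_def caught_def by blast
      ultimately obtain c' where "good (m - Suc n) ?c (r n) c'"
        by (auto simp: good_def)
      from respond_good[OF this] have "good (m - Suc n) ?c (r n) (\<sigma> (map r [0..<Suc n]))"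
        by (simp add: \<sigma>_snoc)
      moreover have "\<not> caught k (\<sigma> (map r [0..<Suc n])) (r n)"
        using free unfolding captured_def caught_def by blast
      ultimately show ?case using r by (simp add: good_def robber_play_def)
    qed
    from this[of m] free show False
      by (auto simp: caught_def captured_def)
  qed
  ultimately show ?thesis unfolding cops_win_def by blast
qed

text \<open>One cop on each vertex catches the robber at once. Hence some number of cops wins, and
  the \<open>LEAST\<close> in \<open>cop_number\<close> is attained.\<close>

lemma cops_win_card_verts:
  assumes "finite (verts D)" "wf_digraph D"
  shows "cops_win D (card (verts D))"
proof -
  obtain f where f: "bij_betw f {..<card (verts D)} (verts D)"
    using ex_bij_betw_nat_finite[OF assms(1)] by (auto simp: atLeast0LessThan)
  show ?thesis
  proof (rule cops_win_if_wins_within[where c = f and m = 0])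
    show "f i \<in> verts D" if "i < card (verts D)" for i
      using that bij_betwE[OF f] by simp
    show "wins_within D (card (verts D)) 0 f x" if "x \<in> verts D" for x
      using that bij_betw_imp_surj_on[OF f] unfolding wins_within.simps caught_def
      by (metis imageE lessThan_iff)
  qed
qed

section \<open>A criterion for the robber\<close>

text \<open>With \<open>S\<close> the set of cop positions, \<open>escape\<close> lets the robber
  always move to a vertex that no cop can reach in the next move. He is then uncaught after that
  move, and \<open>escape\<close> applies again.\<close>

lemma not_cops_win_if_escape:
  assumes wf: "wf_digraph D" and "finite (verts D)" and card: "k < card (verts D)"
    and escape: "\<And>S x. finite S \<Longrightarrow> card S \<le> k \<Longrightarrow> x \<in> verts D - S \<Longrightarrow>
      \<exists>y. may_move D x y \<and> (\<forall>s\<in>S. \<not> may_move D s y)"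
  shows "\<not> cops_win D k"
proof
  assume "cops_win D k"
  then obtain \<sigma> where strat: "cop_strategy D k \<sigma>"
    and wins: "\<And>r. robber_play D r \<Longrightarrow> captured k \<sigma> r"
    unfolding cops_win_def by blast
  define safe where "safe h y \<longleftrightarrow> (\<forall>i<k. \<not> may_move D (\<sigma> h i) y)" for h y
  have escape': "\<exists>y. may_move D x y \<and> safe h y"
    if "x \<in> verts D" "\<not> caught k (\<sigma> h) x" for x h
    using escape[of "\<sigma> h ` {..<k}" x] that card_image_le[of "{..<k}" "\<sigma> h"]
    by (auto simp: safe_def caught_def)
  have "\<not> verts D \<subseteq> \<sigma> [] ` {..<k}"
    using card card_image_le[of "{..<k}" "\<sigma> []"] card_mono[of "\<sigma> [] ` {..<k}" "verts D"] by auto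
  \<comment> \<open>An unoccupied vertex \<open>v\<close> serves as a fictitious position before the
    start: the robber's initial choice is treated as a move from \<open>v\<close>, which makes it
    safe as well.\<close>
  then obtain v where v: "v \<in> verts D" "\<not> caught k (\<sigma> []) v"
    by (auto simp: caught_def)
  \<comment> \<open>The robber's choice depends on his own history only, as \<open>\<sigma>\<close>
    determines the cops from it. Without a safe vertex the default is to stay, so
    \<open>pick\<close> is a legal move for every \<open>h\<close>.\<close>
  define pick where "pick h =
    (if \<exists>y. may_move D (last (v # h)) y \<and> safe h y
     then SOME y. may_move D (last (v # h)) y \<and> safe h y else last (v # h))" for h
  \<comment> \<open>Iterating \<open>pick\<close> builds the history first; \<open>r\<close> is then
    read off from it.\<close>
  define hist where "hist n = ((\<lambda>h. h @ [pick h]) ^^ n) []" for n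
  define r where "r n = pick (hist n)" for n
  have hist: "hist n = map r [0..<n]" for n
    by (induction n) (auto simp: hist_def r_def)
  have pick_move: "may_move D (last (v # h)) (pick h)" for h
  proof (cases "\<exists>y. may_move D (last (v # h)) y \<and> safe h y")
    case True
    then show ?thesis
      using someI_ex[OF True] unfolding pick_def by (simp only: if_True)
  next
    case False
    then show ?thesis unfolding pick_def by (simp only: if_False may_move_def simp_thms)
  qed
  have pick_safe: "safe h (pick h)"
    if "last (v # h) \<in> verts D" "\<not> caught k (\<sigma> h) (last (v # h))" for h
    using someI_ex[OF escape'[OF that]] escape'[OF that] unfolding pick_def by (simp only: if_True)
  have play: "robber_play D r"
    unfolding robber_play_def
  proof (intro conjI allI)
    show "r 0 \<in> verts D"
      using pick_move[of "[]"] verts_if_may_move[OF wf _ v(1)] by (simp add: r_def hist_def)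
    show "may_move D (r n) (r (Suc n))" for n
      using pick_move[of "hist (Suc n)"] by (simp add: r_def[of "Suc n"] hist)
  qed
  have safe: "safe (map r [0..<n]) (r n)" for n
  proof (induction n)
    case 0
    then show ?case using pick_safe[of "[]"] v by (simp add: r_def hist_def)
  next
    case (Suc n)
    have "\<not> caught k (\<sigma> (map r [0..<Suc n])) (r n)"
      using Suc strat play unfolding cop_strategy_def caught_def safe_def by metis
    then show ?case
      using pick_safe[of "map r [0..<Suc n]"] robber_play_in_verts[OF wf play, of n]
      by (simp add: r_def[of "Suc n"] hist)
  qed
  have "captured k \<sigma> r" using wins[OF play] .
  then obtain n i where i: "i < k" and "\<sigma> (map r [0..<n]) i = r n \<or> \<sigma> (map r [0..<Suc n]) i = r n"
    unfolding captured_def by blast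
  \<comment> \<open>Both forms of capture reduce to one: staying in place counts as a move.\<close>
  then have "may_move D (\<sigma> (map r [0..<n]) i) (r n)"
    using strat play unfolding cop_strategy_def by (metis may_move_def)
  with safe i show False unfolding safe_def by blast
qed

text \<open>Pigeonhole: if every neighbour of \<open>x\<close> were covered, choosing a covering cop
  for each would be injective by \<open>girth\<close>, giving at least as many cop positions as
  neighbours. Since \<open>may_move\<close> is reflexive, \<open>girth\<close> excludes triangles
  (\<open>s\<close> equal to \<open>y\<close> or \<open>z\<close>) along with 4-cycles.\<close>

lemma not_cops_win_if_girth_5:
  assumes wf: "wf_digraph D" and fin: "finite (verts D)" and card: "k < card (verts D)"
    and deg: "\<And>x. x \<in> verts D \<Longrightarrow> k < card {y. x \<rightarrow>\<^bsub>D\<^esub> y}"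
    and girth: "\<And>x s y z. \<lbrakk>x \<rightarrow>\<^bsub>D\<^esub> y; x \<rightarrow>\<^bsub>D\<^esub> z; s \<noteq> x; may_move D s y; may_move D s z\<rbrakk> \<Longrightarrow> y = z"
  shows "\<not> cops_win D k"
proof (rule not_cops_win_if_escape[OF wf fin card])
  fix S x assume S: "finite S" "card S \<le> k" and x: "x \<in> verts D - S"
  show "\<exists>y. may_move D x y \<and> (\<forall>s\<in>S. \<not> may_move D s y)"
  proof (rule ccontr)
    assume "\<not> ?thesis"
    then have "\<forall>y\<in>{y. x \<rightarrow>\<^bsub>D\<^esub> y}. \<exists>s\<in>S. may_move D s y"
      by (auto simp: may_move_def)
    then obtain f where f: "\<And>y. x \<rightarrow>\<^bsub>D\<^esub> y \<Longrightarrow> f y \<in> S \<and> may_move D (f y) y"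
      by (metis mem_Collect_eq)
    have "inj_on f {y. x \<rightarrow>\<^bsub>D\<^esub> y}"
      using f girth x by (intro inj_onI) (metis DiffD2 mem_Collect_eq)
    then have "card {y. x \<rightarrow>\<^bsub>D\<^esub> y} \<le> card S"
      using S(1) f by (intro card_inj_on_le[of f]) auto
    with deg[of x] S(2) x show False by simp
  qed
qed

section \<open>The Petersen graph\<close>

text \<open>The outer cycle 0 to 4, the spokes from i to i + 5, and the inner pentagram 5-7-9-6-8,
  each edge in both directions.\<close>

definition petersen_arcs :: "(nat \<times> nat) list" where
  "petersen_arcs =
     (let es = [(0,1), (1,2), (2,3), (3,4), (4,0), (0,5), (1,6), (2,7), (3,8), (4,9),
                (5,7), (7,9), (9,6), (6,8), (8,5)]
      in es @ map prod.swap es)"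

definition petersen :: "nat pair_pre_digraph" where
  "petersen = \<lparr>pverts = {..<10}, parcs = set petersen_arcs\<rparr>"

lemma petersen_simps [simp]:
  "pverts petersen = {..<10}" "parcs petersen = set petersen_arcs"
  by (simp_all add: petersen_def)

lemma petersen_arcs_less: "\<forall>(u, v)\<in>set petersen_arcs. u < 10 \<and> v < 10 \<and> u \<noteq> v"
  by code_simp

lemma petersen_arcs_sym:
  assumes "(u, v) \<in> set petersen_arcs"
  shows "(v, u) \<in> set petersen_arcs"
proof -
  have "\<forall>(u, v)\<in>set petersen_arcs. (v, u) \<in> set petersen_arcs"
    by code_simp
  with assms show ?thesis by blast
qed

lemma pair_graph_petersen: "pair_graph petersen"
  using petersen_arcs_less
  by unfold_locales
    (auto simp: symmetric_def petersen_arcs_sym intro!: symI)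

lemma petersen_degree: "\<forall>x\<in>set [0..<10]. card (snd ` {e \<in> set petersen_arcs. fst e = x}) = 3"
  by code_simp

text \<open>No triangles and no 4-cycles, with quantifiers bounded by the arc list so that the claim
  can be evaluated.\<close>

lemma petersen_girth:
  "\<forall>(x, y)\<in>set petersen_arcs. \<forall>(x', z)\<in>set petersen_arcs. x' = x \<longrightarrow> y \<noteq> z \<longrightarrow>
     (y, z) \<notin> set petersen_arcs \<and>
     (\<forall>(s, y')\<in>set petersen_arcs. y' = y \<longrightarrow> (s, z) \<in> set petersen_arcs \<longrightarrow> s = x)"
  by code_simp

lemma not_cops_win_petersen:
  assumes "k \<le> 2"
  shows "\<not> cops_win (with_proj petersen) k"
proof (rule not_cops_win_if_girth_5)
  interpret pair_graph petersen by (rule pair_graph_petersen)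
  show "wf_digraph (with_proj petersen)" ..
  show "finite (verts (with_proj petersen))" "k < card (verts (with_proj petersen))"
    using assms by simp_all
next
  fix x assume "x \<in> verts (with_proj petersen)"
  then have "card (snd ` {e \<in> set petersen_arcs. fst e = x}) = 3"
    using petersen_degree by simp
  moreover have "snd ` {e \<in> set petersen_arcs. fst e = x} = {y. x \<rightarrow>\<^bsub>with_proj petersen\<^esub> y}"
    by force
  ultimately show "k < card {y. x \<rightarrow>\<^bsub>with_proj petersen\<^esub> y}"
    using assms by simp
next
  fix x s y z
  assume arcs: "x \<rightarrow>\<^bsub>with_proj petersen\<^esub> y" "x \<rightarrow>\<^bsub>with_proj petersen\<^esub> z"
    and s: "s \<noteq> x" "may_move (with_proj petersen) s y" "may_move (with_proj petersen) s z"
  show "y = z"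
  proof (rule ccontr)
    assume "y \<noteq> z"
    have "\<forall>(x', z)\<in>set petersen_arcs. x' = x \<longrightarrow> y \<noteq> z \<longrightarrow> (y, z) \<notin> set petersen_arcs \<and>
        (\<forall>(s, y')\<in>set petersen_arcs. y' = y \<longrightarrow> (s, z) \<in> set petersen_arcs \<longrightarrow> s = x)"
      using bspec[OF petersen_girth, of "(x, y)"] arcs(1)
      unfolding with_proj_simps petersen_simps prod.case .
    from bspec[OF this, of "(x, z)"] arcs(2) \<open>y \<noteq> z\<close>
    have yz: "(y, z) \<notin> set petersen_arcs"
      and common: "\<forall>(s, y')\<in>set petersen_arcs. y' = y \<longrightarrow> (s, z) \<in> set petersen_arcs \<longrightarrow> s = x"
      by simp_all
    have "\<not> ((s, y) \<in> set petersen_arcs \<and> (s, z) \<in> set petersen_arcs)"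
      using bspec[OF common, of "(s, y)"] s(1) by auto
    moreover have "(z, y) \<notin> set petersen_arcs"
      using yz petersen_arcs_sym by blast
    ultimately show False
      using s yz \<open>y \<noteq> z\<close> unfolding may_move_def with_proj_simps petersen_simps by blast
  qed
qed

section \<open>Existence of a strong orientation\<close>

definition petersen_strong_orientation :: "nat pair_pre_digraph" where
  "petersen_strong_orientation = \<lparr>pverts = {..<10}, parcs =
     {(0,1), (1,2), (2,3), (3,4), (4,9), (9,7), (7,5), (5,8), (8,6), (6,9), (5,0),
      (0,4), (1,6), (2,7), (3,8)}\<rparr>"

lemma orientation_of_petersen_strong_orientation:
  "orientation_of petersen_strong_orientation petersen"
proof -
  have "pair_digraph petersen_strong_orientation"
    by unfold_locales (auto simp: petersen_strong_orientation_def)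
  moreover have "asym (parcs petersen_strong_orientation)"
    by (rule asymI) (auto simp: petersen_strong_orientation_def)
  moreover have "mk_symmetric (with_proj petersen_strong_orientation) = petersen"
    by (auto simp: mk_symmetric_def petersen_def petersen_strong_orientation_def
        petersen_arcs_def Let_def)
  ultimately show ?thesis by (simp add: orientation_of_def oriented_graph_def)
qed

text \<open>The directed 8-cycle 0-1-2-3-4-9-7-5 together with the directed path 5-8-6-9 meets every
  vertex. It suffices that each vertex is reachable from 0 and reaches 0.\<close>

lemma strongly_connected_petersen_strong_orientation:
  "strongly_connected (with_proj petersen_strong_orientation)"
proof -
  let ?D = "with_proj petersen_strong_orientation"
  interpret pair_digraph petersen_strong_orientation
    using orientation_of_petersen_strong_orientation
    by (simp add: orientation_of_def oriented_graph_def)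
  have step: "u \<rightarrow>\<^sup>*\<^bsub>?D\<^esub> v" if "(u, v) \<in> parcs petersen_strong_orientation" for u v
    using that by (intro reachable_adjI) simp
  have path: "0 \<rightarrow>\<^sup>*\<^bsub>?D\<^esub> 1" "1 \<rightarrow>\<^sup>*\<^bsub>?D\<^esub> 2" "2 \<rightarrow>\<^sup>*\<^bsub>?D\<^esub> 3" "3 \<rightarrow>\<^sup>*\<^bsub>?D\<^esub> 4" "4 \<rightarrow>\<^sup>*\<^bsub>?D\<^esub> 9"
    "9 \<rightarrow>\<^sup>*\<^bsub>?D\<^esub> 7" "7 \<rightarrow>\<^sup>*\<^bsub>?D\<^esub> 5" "5 \<rightarrow>\<^sup>*\<^bsub>?D\<^esub> 8" "8 \<rightarrow>\<^sup>*\<^bsub>?D\<^esub> 6" "6 \<rightarrow>\<^sup>*\<^bsub>?D\<^esub> 9" "5 \<rightarrow>\<^sup>*\<^bsub>?D\<^esub> 0"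
    by (rule step, simp add: petersen_strong_orientation_def)+
  note to2 = reachable_trans[OF path(1) path(2)]
  note to3 = reachable_trans[OF to2 path(3)]
  note to4 = reachable_trans[OF to3 path(4)]
  note to9 = reachable_trans[OF to4 path(5)]
  note to7 = reachable_trans[OF to9 path(6)]
  note to5 = reachable_trans[OF to7 path(7)]
  note to8 = reachable_trans[OF to5 path(8)]
  note to6 = reachable_trans[OF to8 path(9)]
  note from7 = reachable_trans[OF path(7) path(11)]
  note from9 = reachable_trans[OF path(6) from7]
  note from6 = reachable_trans[OF path(10) from9]
  note from8 = reachable_trans[OF path(9) from6]
  note from4 = reachable_trans[OF path(5) from9]
  note from3 = reachable_trans[OF path(4) from4]
  note from2 = reachable_trans[OF path(3) from3]
  note from1 = reachable_trans[OF path(2) from2]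
  have "0 \<rightarrow>\<^sup>*\<^bsub>?D\<^esub> v \<and> v \<rightarrow>\<^sup>*\<^bsub>?D\<^esub> 0" if "v \<in> verts ?D" for v
  proof -
    have "v \<in> {0, 1, 2, 3, 4, 5, 6, 7, 8, 9}"
      using that by (auto simp: petersen_strong_orientation_def)
    then show ?thesis
      using path to2 to3 to4 to9 to7 to5 to8 to6 from1 from2 from3 from4 from6 from7 from8 from9
        reachable_trans[OF path(1) from1]
      by (elim insertE emptyE) (simp_all only: simp_thms)
  qed
  then have "u \<rightarrow>\<^sup>*\<^bsub>?D\<^esub> v" if "u \<in> verts ?D" "v \<in> verts ?D" for u v
    using that reachable_trans by blast
  moreover have "0 \<in> verts ?D" by (simp add: petersen_strong_orientation_def)
  ultimately show ?thesis by (intro strongly_connectedI) auto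
qed

section \<open>Strong orientations of the Petersen graph\<close>

text \<open>A list of arcs stands for a partial orientation; the remaining edges are undetermined.\<close>

definition automorphism :: "(nat \<Rightarrow> nat) \<Rightarrow> bool" where
  "automorphism f \<longleftrightarrow> inj_on f {..<10} \<and> f ` {..<10} \<subseteq> {..<10} \<and>
     (\<forall>(u, v)\<in>set petersen_arcs. (f u, f v) \<in> set petersen_arcs)"

text \<open>The quantifier over \<open>f\<close> makes this a property of all symmetric copies of
  \<open>K\<close>, so that a partial orientation settled once can be used wherever a copy of it
  occurs.\<close>

definition two_cops_win_on :: "(nat \<times> nat) list \<Rightarrow> bool" where
  "two_cops_win_on K \<longleftrightarrow> (\<forall>f D. automorphism f \<longrightarrow> orientation_of D petersen \<longrightarrow>
     strongly_connected (with_proj D) \<longrightarrow> (\<forall>(u, v)\<in>set K. (f u, f v) \<in> parcs D) \<longrightarrow>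
     cops_win (with_proj D) 2)"

lemma automorphismD:
  assumes "automorphism f"
  shows "inj_on f {..<10}" "f ` {..<10} \<subseteq> {..<10}"
    and "(u, v) \<in> set petersen_arcs \<Longrightarrow> (f u, f v) \<in> set petersen_arcs"
proof -
  show "inj_on f {..<10}" "f ` {..<10} \<subseteq> {..<10}"
    using assms unfolding automorphism_def by simp_all
  have "\<forall>(u, v)\<in>set petersen_arcs. (f u, f v) \<in> set petersen_arcs"
    using assms unfolding automorphism_def by (elim conjE)
  from bspec[OF this, of "(u, v)"]
  show "(u, v) \<in> set petersen_arcs \<Longrightarrow> (f u, f v) \<in> set petersen_arcs" by simp
qed

text \<open>\<open>automorphism\<close> demands only that arcs are preserved. As the arc set is
  finite and \<open>f\<close> injective, the induced map on arcs is onto, so arcs are reflected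
  too.\<close>

lemma automorphism_arc_iff:
  assumes "automorphism f" "u < 10" "v < 10"
  shows "(f u, f v) \<in> set petersen_arcs \<longleftrightarrow> (u, v) \<in> set petersen_arcs"
proof
  let ?A = "set petersen_arcs" and ?f = "map_prod f f"
  have A: "?A \<subseteq> {..<10} \<times> {..<10}"
  proof
    show "e \<in> {..<10} \<times> {..<10}" if "e \<in> ?A" for e
      using bspec[OF petersen_arcs_less that] by (cases e) simp
  qed
  have inj: "inj_on ?f ({..<10} \<times> {..<10})"
    by (intro map_prod_inj_on automorphismD(1)[OF assms(1)])
  have "?f ` ?A \<subseteq> ?A"
  proof (rule image_subsetI)
    show "?f e \<in> ?A" if "e \<in> ?A" for e
      using that automorphismD(3)[OF assms(1), of "fst e" "snd e"] by (simp add: map_prod_def case_prod_beta)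
  qed
  then have onto: "?f ` ?A = ?A"
    using inj_on_subset[OF inj A] by (intro endo_inj_surj) auto
  assume "(f u, f v) \<in> ?A"
  with onto obtain e where "e \<in> ?A" "?f (u, v) = ?f e" by (metis imageE map_prod_simp)
  moreover from this A have "e = (u, v)"
    using inj_onD[OF inj, of "(u, v)" e] assms(2,3) by auto
  ultimately show "(u, v) \<in> ?A" by simp
qed (rule automorphismD(3)[OF assms(1)])

lemma automorphism_onto:
  assumes "automorphism f"
  shows "f ` {..<10} = {..<10}"
  by (intro endo_inj_surj automorphismD[OF assms]) simp

lemma automorphism_id: "automorphism id"
  by (auto simp: automorphism_def)

lemma automorphism_comp:
  assumes f: "automorphism f" and g: "automorphism g"
  shows "automorphism (f \<circ> g)"
  unfolding automorphism_def
proof (intro conjI)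
  have "inj_on f (g ` {..<10})"
    using automorphismD(1)[OF f] automorphism_onto[OF g] by simp
  then show "inj_on (f \<circ> g) {..<10}"
    by (intro comp_inj_on automorphismD(1)[OF g])
  show "(f \<circ> g) ` {..<10} \<subseteq> {..<10}"
    using automorphism_onto[OF f] automorphism_onto[OF g] unfolding image_comp[symmetric] by simp
  show "\<forall>(u, v)\<in>set petersen_arcs. ((f \<circ> g) u, (f \<circ> g) v) \<in> set petersen_arcs"
    unfolding comp_def by (safe intro!: automorphismD(3)[OF f] automorphismD(3)[OF g])
qed

text \<open>A permutation given by its list of values, so that being an automorphism can be
  evaluated.\<close>

definition automorphism_list :: "nat list \<Rightarrow> bool" where
  "automorphism_list p \<longleftrightarrow> distinct p \<and> length p = 10 \<and> (\<forall>x\<in>set p. x < 10) \<and>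
     (\<forall>(u, v)\<in>set petersen_arcs. (p ! u, p ! v) \<in> set petersen_arcs)"

lemma automorphism_nth: "automorphism_list p \<Longrightarrow> automorphism (nth p)"
  unfolding automorphism_list_def automorphism_def
  by (elim conjE, intro conjI) (simp_all add: inj_on_nth image_subset_iff)

lemma orientation_of_petersenD:
  assumes "orientation_of D petersen"
  shows "pair_digraph D" "pverts D = {..<10}" "asym (parcs D)"
    and "set petersen_arcs = parcs D \<union> (parcs D)\<inverse>"
proof -
  have sym: "mk_symmetric (with_proj D) = petersen"
    and "pair_digraph D" "asym (parcs D)"
    using assms by (simp_all add: orientation_of_def oriented_graph_def)
  then show "pair_digraph D" "asym (parcs D)" by simp_all
  show "pverts D = {..<10}"
    using arg_cong[OF sym, of pverts] by (simp add: mk_symmetric_def)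
  show "set petersen_arcs = parcs D \<union> (parcs D)\<inverse>"
  proof -
    have "set petersen_arcs = (\<Union>e\<in>parcs D. {(fst e, snd e), (snd e, fst e)})"
      using arg_cong[OF sym, of parcs] by (simp add: mk_symmetric_def)
    then show ?thesis by force
  qed
qed

lemma strongly_connected_leaves:
  assumes "strongly_connected D" "S \<subset> verts D" "S \<noteq> {}"
  shows "\<exists>u\<in>S. \<exists>v. v \<notin> S \<and> u \<rightarrow>\<^bsub>D\<^esub> v"
proof (rule ccontr)
  assume closed: "\<not> ?thesis"
  obtain s t where "s \<in> S" "t \<in> verts D" "t \<notin> S" using assms by blast
  then have "s \<rightarrow>\<^sup>*\<^bsub>D\<^esub> t" using assms by auto
  then have "(s, t) \<in> (arcs_ends D)\<^sup>*"
    unfolding reachable_def by (rule rtrancl_on_rtranclI)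
  then have "t \<in> S"
    by induction (use \<open>s \<in> S\<close> closed in auto)
  with \<open>t \<notin> S\<close> show False ..
qed

subsection \<open>Winning tables\<close>

text \<open>
  A robber is confined only by the arcs of \<open>K\<close>: undetermined edges are open to him in both
  directions, and closed to the cops.
\<close>

definition robber_steps :: "(nat \<times> nat) list \<Rightarrow> nat \<Rightarrow> nat list" where
  "robber_steps K x =
     x # map snd (filter (\<lambda>(u, v). u = x \<and> (v, u) \<notin> set K) petersen_arcs)"

text \<open>
  An entry \<open>((a, b, x), a', b')\<close> lets cops on \<open>a\<close> and \<open>b\<close>, with the robber on \<open>x\<close>, move to
  \<open>a'\<close> and \<open>b'\<close>; the entries for the resulting positions come later in the list.
\<close>

fun winning_table ::
    "(nat \<times> nat) list \<Rightarrow> ((nat \<times> nat \<times> nat) \<times> nat \<times> nat) list \<Rightarrow> bool" where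
  "winning_table K [] \<longleftrightarrow> True"
| "winning_table K (((a, b, x), a', b') # T) \<longleftrightarrow>
     (a = a' \<or> (a, a') \<in> set K) \<and> (b = b' \<or> (b, b') \<in> set K) \<and>
     (x = a' \<or> x = b' \<or> (\<forall>y\<in>set (robber_steps K x).
        y = a' \<or> y = b' \<or> (a', b', y) \<in> fst ` set T)) \<and>
     winning_table K T"

definition place :: "'a \<Rightarrow> 'a \<Rightarrow> nat \<Rightarrow> 'a" where
  "place a b i = (if i = 0 then a else b)"

lemma caught_place: "caught 2 (place a b) x \<longleftrightarrow> a = x \<or> b = x"
  by (auto simp: caught_def place_def less_2_cases_iff)

lemma cops_move_place:
  "cops_move D 2 (place a b) (place a' b') \<longleftrightarrow> may_move D a a' \<and> may_move D b b'"
  by (auto simp: cops_move_def place_def less_2_cases_iff)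

text \<open>Pulled back along \<open>f\<close>, each real move of the robber is allowed by
  \<open>robber_steps\<close>: it follows an edge of the graph, and by asymmetry it cannot run
  against an arc of \<open>K\<close>.\<close>

lemma robber_steps_if_may_move:
  assumes f: "automorphism f" and D: "orientation_of D petersen"
    and K: "\<forall>(u, v)\<in>set K. (f u, f v) \<in> parcs D"
    and x: "x < 10" and move: "may_move (with_proj D) (f x) z"
  shows "\<exists>y\<in>set (robber_steps K x). y < 10 \<and> z = f y"
proof (cases "z = f x")
  case True
  then show ?thesis using x by (auto simp: robber_steps_def)
next
  case False
  note D' = orientation_of_petersenD[OF D]
  interpret pair_digraph D by (rule D'(1))
  have arc: "(f x, z) \<in> parcs D" using False move by (auto simp: may_move_def)
  then have "z \<in> {..<10}" using in_arcsD2 D'(2) by blast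
  then obtain y where y: "y < 10" "z = f y" using automorphism_onto[OF f] by blast
  have "(x, y) \<in> set petersen_arcs"
    using arc D'(4) y x automorphism_arc_iff[OF f] by blast
  moreover have "(y, x) \<notin> set K"
    using K arc y(2) asymD[OF D'(3)] by blast
  ultimately have "y \<in> set (robber_steps K x)"
    by (force simp: robber_steps_def)
  with y show ?thesis by blast
qed

text \<open>Each entry leads only to captures or to positions in its tail, so induction over the
  list applies and its length bounds the number of moves.\<close>

lemma wins_within_if_winning_table:
  assumes f: "automorphism f" and D: "orientation_of D petersen"
    and K: "\<forall>(u, v)\<in>set K. (f u, f v) \<in> parcs D"
    and "winning_table K T" "(a, b, x) \<in> fst ` set T" "x < 10"
  shows "wins_within (with_proj D) 2 (length T) (place (f a) (f b)) (f x)"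
  using assms(4-)
proof (induction T arbitrary: a b x)
  case Nil
  then show ?case by simp
next
  case (Cons e T)
  obtain a0 b0 x0 a' b' where e: "e = ((a0, b0, x0), a', b')" by (metis surj_pair)
  let ?D = "with_proj D" and ?c' = "place (f a') (f b')"
  have T: "winning_table K T"
    and move: "a0 = a' \<or> (a0, a') \<in> set K" "b0 = b' \<or> (b0, b') \<in> set K"
    and catch: "x0 = a' \<or> x0 = b' \<or> (\<forall>y\<in>set (robber_steps K x0).
        y = a' \<or> y = b' \<or> (a', b', y) \<in> fst ` set T)"
    using Cons.prems(1) unfolding e by simp_all
  show ?case
  \<comment> \<open>A position that occurs again in the tail is settled there; otherwise the head
    entry is the one for it.\<close>
  proof (cases "(a, b, x) \<in> fst ` set T")
    case True
    then show ?thesis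
      using Cons.IH[OF T _ Cons.prems(3)] wins_within_Suc by (metis length_Cons)
  next
    case False
    with Cons.prems(2) have eq: "a = a0" "b = b0" "x = x0" by (auto simp: e)
    have "cops_move ?D 2 (place (f a) (f b)) ?c'"
      unfolding cops_move_place may_move_def eq using move K by auto
    moreover have "caught 2 ?c' (f x) \<or>
        (\<forall>z. may_move ?D (f x) z \<longrightarrow> wins_within ?D 2 (length T) ?c' z)"
    proof (cases "x = a' \<or> x = b'")
      case True
      then show ?thesis by (auto simp: caught_place)
    next
      case False
      have "wins_within ?D 2 (length T) ?c' z" if z: "may_move ?D (f x) z" for z
      proof -
        obtain y where y: "y \<in> set (robber_steps K x)" "y < 10" "z = f y"
          using robber_steps_if_may_move[OF f D K Cons.prems(3) z] by blast
        consider "y = a' \<or> y = b'" | "(a', b', y) \<in> fst ` set T"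
          using catch False y(1) unfolding eq by blast
        then show ?thesis
        proof cases
          case 1
          then have "wins_within ?D 2 0 ?c' z" by (auto simp: caught_place y(3))
          then show ?thesis by (rule wins_within_mono[rotated]) simp
        next
          case 2
          then show ?thesis using Cons.IH[OF T _ y(2)] y(3) by simp
        qed
      qed
      then show ?thesis by blast
    qed
    ultimately show ?thesis by auto
  qed
qed

lemma two_cops_win_on_if_winning_table:
  assumes T: "winning_table K T" and ab: "a < 10" "b < 10"
    and start: "\<forall>x\<in>set [0..<10]. x = a \<or> x = b \<or> (a, b, x) \<in> fst ` set T"
  shows "two_cops_win_on K"
  unfolding two_cops_win_on_def
proof (intro allI impI)
  fix f D
  assume f: "automorphism f" and D: "orientation_of D petersen"
    and K: "\<forall>(u, v)\<in>set K. (f u, f v) \<in> parcs D"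
  have V: "verts (with_proj D) = f ` {..<10}"
    using orientation_of_petersenD(2)[OF D] automorphism_onto[OF f] by simp
  show "cops_win (with_proj D) 2"
  proof (rule cops_win_if_wins_within)
    show "place (f a) (f b) i \<in> verts (with_proj D)" for i
      unfolding V using ab by (simp add: place_def)
    show "wins_within (with_proj D) 2 (length T) (place (f a) (f b)) z"
      if z: "z \<in> verts (with_proj D)" for z
    proof -
      obtain x where x: "x < 10" "z = f x" using z unfolding V by blast
      then have "x \<in> set [0..<10]" by simp
      with start consider "x = a \<or> x = b" | "(a, b, x) \<in> fst ` set T" by blast
      then show ?thesis
      proof cases
        case 1
        then have "wins_within (with_proj D) 2 0 (place (f a) (f b)) z"
          by (auto simp: caught_place x(2))
        then show ?thesis by (rule wins_within_mono[rotated]) simp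
      next
        case 2
        then show ?thesis using wins_within_if_winning_table[OF f D K T _ x(1)] x(2) by simp
      qed
    qed
  qed
qed

subsection \<open>Case distinctions\<close>

text \<open>
  \<open>Cut S\<close> closes a branch in which all edges between \<open>S\<close> and its complement point the same
  way, so that the orientation is not strong. \<open>Image i p\<close> closes a branch containing the image
  under the automorphism \<open>p\<close> of the \<open>i\<close>-th partial orientation in a list of those already
  known to be won by the cops.
\<close>

datatype case_tree =
    Split nat nat case_tree case_tree
  | Cut "nat list"
  | Image nat "nat list"

text \<open>All edges at the boundary of \<open>S\<close> point outwards; applied to the swapped
  arcs, it says that they point inwards.\<close>

definition directed_cut :: "(nat \<times> nat) list \<Rightarrow> nat list \<Rightarrow> bool" where
  "directed_cut K S \<longleftrightarrow>
     (\<forall>(u, v)\<in>set petersen_arcs. u \<in> set S \<longrightarrow> v \<notin> set S \<longrightarrow> (u, v) \<in> set K)"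

primrec covers ::
    "(nat \<times> nat) list list \<Rightarrow> (nat \<times> nat) list \<Rightarrow> case_tree \<Rightarrow> bool" where
  "covers Ks K (Split u v t t') \<longleftrightarrow> (u, v) \<in> set petersen_arcs \<and>
     covers Ks ((u, v) # K) t \<and> covers Ks ((v, u) # K) t'"
| "covers Ks K (Cut S) \<longleftrightarrow>
     (\<exists>u\<in>set [0..<10]. u \<in> set S) \<and> (\<exists>u\<in>set [0..<10]. u \<notin> set S) \<and>
     (directed_cut K S \<or> directed_cut (map prod.swap K) S)"
| "covers Ks K (Image i p) \<longleftrightarrow> i < length Ks \<and> automorphism_list p \<and>
     (\<forall>(u, v)\<in>set (Ks ! i). (p ! u, p ! v) \<in> set K)"

lemma not_strongly_connected_if_directed_cut:
  assumes f: "automorphism f" and D: "orientation_of D petersen"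
    and K: "\<forall>(u, v)\<in>set K. (f u, f v) \<in> parcs D"
    and u: "u < 10" "u \<in> S" and w: "w < 10" "w \<notin> S"
    and cut: "\<And>u v. \<lbrakk>(u, v) \<in> set petersen_arcs; u \<in> S; v \<notin> S\<rbrakk> \<Longrightarrow> (u, v) \<in> set K"
  shows "\<not> strongly_connected (with_proj D)"
proof
  assume strong: "strongly_connected (with_proj D)"
  note D' = orientation_of_petersenD[OF D]
  interpret pair_digraph D by (rule D'(1))
  let ?O = "f ` ({..<10} - S)"
  have "f u \<notin> ?O" "f u \<in> {..<10}"
    using u inj_onD[OF automorphismD(1)[OF f]] automorphism_onto[OF f] by blast+
  moreover have "?O \<subseteq> {..<10}" and ne: "?O \<noteq> {}"
    using w automorphism_onto[OF f] by blast+
  ultimately have "?O \<subset> verts (with_proj D)"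
    unfolding with_proj_simps D'(2) by blast
  from strongly_connected_leaves[OF strong this ne]
  obtain x y where x: "x \<in> ?O" and y: "y \<notin> ?O" and xy: "(x, y) \<in> parcs D"
    unfolding with_proj_simps by blast
  obtain a where a: "a < 10" "a \<notin> S" "x = f a" using x by blast
  have "y \<in> {..<10}" using xy in_arcsD2 D'(2) by blast
  then obtain b where b: "b < 10" "b \<in> S" "y = f b"
    using y automorphism_onto[OF f] by blast
  have "(b, a) \<in> set petersen_arcs"
    using automorphism_arc_iff[OF f b(1) a(1)] xy D'(4) a(3) b(3) by blast
  then have "(b, a) \<in> set K" using a(2) b(2) by (intro cut)
  then have "(y, x) \<in> parcs D" using K a(3) b(3) by blast
  with xy show False using asymD[OF D'(3)] by blast
qed

text \<open>Soundness of the certificates: \<open>D\<close> directs each split edge one way or the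
  other, a cut contradicts strong connectivity, and an image is absorbed by composing
  \<open>f\<close> with the automorphism.\<close>

lemma two_cops_win_on_if_covers:
  assumes "\<forall>L\<in>set Ks. two_cops_win_on L" "covers Ks K t"
  shows "two_cops_win_on K"
  using assms(2)
proof (induction t arbitrary: K)
  case (Split u v t t')
  have uv: "(u, v) \<in> set petersen_arcs"
    and wins: "two_cops_win_on ((u, v) # K)" "two_cops_win_on ((v, u) # K)"
    using Split by auto
  show ?case
    unfolding two_cops_win_on_def
  proof (intro allI impI)
    fix f D
    assume f: "automorphism f" and D: "orientation_of D petersen"
      and strong: "strongly_connected (with_proj D)"
      and K: "\<forall>(u, v)\<in>set K. (f u, f v) \<in> parcs D"
    have "(f u, f v) \<in> set petersen_arcs"
      using uv by (rule automorphismD(3)[OF f])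
    then consider "(f u, f v) \<in> parcs D" | "(f v, f u) \<in> parcs D"
      using orientation_of_petersenD(4)[OF D] by blast
    then show "cops_win (with_proj D) 2"
      using wins f D strong K unfolding two_cops_win_on_def by cases simp_all
  qed
next
  case (Cut S)
  then obtain u w where u: "u < 10" "u \<in> set S" and w: "w < 10" "w \<notin> set S"
    and cut: "directed_cut K S \<or> directed_cut (map prod.swap K) S" by auto
  show ?case
    unfolding two_cops_win_on_def
  proof (intro allI impI)
    fix f D
    assume f: "automorphism f" and D: "orientation_of D petersen"
      and strong: "strongly_connected (with_proj D)"
      and K: "\<forall>(u, v)\<in>set K. (f u, f v) \<in> parcs D"
    note no_cut = not_strongly_connected_if_directed_cut[OF f D K]
    from cut have "\<not> strongly_connected (with_proj D)"
    proof
      assume "directed_cut K S"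
      then show ?thesis
        using no_cut[OF u w] unfolding directed_cut_def by blast
    next
      assume cut: "directed_cut (map prod.swap K) S"
      show ?thesis
      \<comment> \<open>Edges that all point into \<open>S\<close> leave its complement.\<close>
      proof (rule no_cut)
        fix a b assume "(a, b) \<in> set petersen_arcs" "a \<in> - set S" "b \<notin> - set S"
        then have "(b, a) \<in> set (map prod.swap K)"
          using cut petersen_arcs_sym[of a b] unfolding directed_cut_def by blast
        then show "(a, b) \<in> set K" by auto
      qed (use u w in auto)
    qed
    with strong show "cops_win (with_proj D) 2" by contradiction
  qed
next
  case (Image i p)
  let ?L = "Ks ! i"
  have L: "two_cops_win_on ?L" and p: "automorphism (nth p)"
    and sub: "\<forall>(u, v)\<in>set ?L. (p ! u, p ! v) \<in> set K"
    using Image assms(1) automorphism_nth by auto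
  show ?case
    unfolding two_cops_win_on_def
  proof (intro allI impI)
    fix f D
    assume f: "automorphism f" and D: "orientation_of D petersen"
      and strong: "strongly_connected (with_proj D)"
      and K: "\<forall>(u, v)\<in>set K. (f u, f v) \<in> parcs D"
    have "\<forall>(u, v)\<in>set ?L. ((f \<circ> nth p) u, (f \<circ> nth p) v) \<in> parcs D"
      using K sub unfolding comp_def by blast
    then show "cops_win (with_proj D) 2"
      using L automorphism_comp[OF f p] D strong unfolding two_cops_win_on_def by blast
  qed
qed

subsection \<open>The strategies\<close>

text \<open>A directed 5-cycle 0-1-2-3-4 and a directed 6-cycle 0-5-8-6-9-4 sharing the arc from 4
  to 0, and an arc into 9 from the remaining vertex 7.\<close>

definition pattern_A :: "(nat \<times> nat) list" where
  "pattern_A =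
     [(0,1), (0,5), (1,2), (2,3), (3,4), (4,0), (5,8), (6,9), (7,9), (8,6), (9,4)]"

definition pattern_A_table :: "((nat \<times> nat \<times> nat) \<times> nat \<times> nat) list" where
  "pattern_A_table =
     [((0,7,6),0,9), ((0,9,1),1,4), ((0,9,6),0,4), ((0,4,9),5,4), ((5,4,9),8,4), ((8,4,9),6,4),
      ((6,4,9),9,4), ((0,4,1),1,0), ((0,4,6),5,0), ((5,0,9),8,0), ((8,0,4),6,0), ((5,0,1),8,1),
      ((5,0,6),8,0), ((8,0,9),6,0), ((6,0,4),9,0), ((9,0,4),4,5), ((6,0,9),9,0), ((8,0,1),6,1),
      ((8,0,6),6,1), ((0,7,1),1,7), ((0,7,9),5,9), ((0,7,4),0,9), ((0,7,8),1,9), ((1,9,6),2,4),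
      ((0,7,2),1,7), ((1,7,3),1,9), ((1,7,2),2,7), ((0,7,5),5,9), ((0,7,3),1,9), ((1,9,8),2,4),
      ((1,9,4),2,4), ((1,9,3),2,4), ((2,4,8),2,0), ((2,0,3),3,0), ((2,0,8),2,5), ((2,5,6),2,8),
      ((2,8,9),3,6), ((3,6,4),4,9), ((3,6,9),3,9), ((2,8,1),2,6), ((2,6,1),2,9), ((2,9,6),2,4),
      ((2,4,9),3,0), ((3,0,4),4,5), ((2,9,1),2,4), ((2,4,6),3,0), ((2,4,1),2,0), ((2,0,6),3,0),
      ((3,0,9),4,5), ((3,0,1),3,1), ((3,0,6),4,0), ((4,0,9),4,5), ((4,5,9),4,8), ((4,8,9),4,6),
      ((4,6,9),4,9), ((4,0,1),4,1), ((4,0,6),0,5), ((0,5,9),0,8), ((0,8,4),0,6), ((0,5,1),1,5),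
      ((0,5,6),0,8), ((0,8,9),0,6), ((0,6,4),0,9), ((0,9,4),1,4), ((0,6,9),5,9), ((0,8,1),1,6),
      ((0,8,6),0,6), ((2,0,1),3,1), ((2,8,6),3,6), ((2,5,3),3,5), ((2,5,8),2,8), ((2,4,3),3,0)]"

lemma two_cops_win_on_pattern_A: "two_cops_win_on pattern_A"
proof (rule two_cops_win_on_if_winning_table[where T = pattern_A_table and a = 0 and b = 7])
  show "winning_table pattern_A pattern_A_table" by code_simp
  show "\<forall>x\<in>set [0..<10]. x = 0 \<or> x = 7 \<or> (0, 7, x) \<in> fst ` set pattern_A_table"
    by code_simp
qed simp_all

text \<open>A directed 5-cycle 0-1-2-3-4, with a detour from 0 to 1 that enters at 5, splits into
  5-8-6 and 5-7-9-6, and returns from 6.\<close>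

definition pattern_B :: "(nat \<times> nat) list" where
  "pattern_B =
     [(0,1), (0,5), (1,2), (2,3), (3,4), (4,0), (5,7), (5,8), (6,1), (7,9), (8,6), (9,6)]"

definition pattern_B_table :: "((nat \<times> nat \<times> nat) \<times> nat \<times> nat) list" where
  "pattern_B_table =
     [((0,2,6),5,2), ((5,2,1),8,2), ((0,2,1),1,2), ((0,2,9),0,3), ((0,3,6),0,4), ((0,4,1),1,4),
      ((0,4,6),5,0), ((5,0,1),5,1), ((5,0,6),8,0), ((0,2,4),0,3), ((0,3,9),5,4), ((5,4,6),8,0),
      ((8,0,1),8,1), ((8,0,6),6,5), ((5,4,9),7,4), ((7,4,6),9,0), ((9,0,1),6,1), ((9,0,6),6,1),
      ((7,4,9),9,4), ((0,3,4),5,4), ((0,2,8),5,2), ((5,2,6),8,2), ((8,2,1),6,2), ((6,2,1),1,2),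
      ((8,2,6),6,3), ((5,2,3),8,3), ((5,2,8),8,3), ((0,2,5),5,2), ((0,2,7),5,2), ((5,2,9),8,3),
      ((8,3,6),6,4), ((8,3,4),8,4), ((8,3,9),6,4), ((6,4,9),1,4), ((1,4,6),1,0), ((1,0,6),1,5),
      ((1,5,6),1,8), ((1,4,9),2,4), ((2,4,6),3,0), ((3,0,1),3,1), ((2,4,9),3,0), ((3,0,6),4,0),
      ((4,0,1),4,1), ((4,0,6),0,5), ((0,5,1),1,7), ((0,5,6),1,8), ((1,8,6),2,6), ((3,0,4),4,0),
      ((3,0,9),4,5), ((4,5,6),0,8), ((0,8,1),1,6), ((0,8,6),0,6), ((4,5,9),4,7), ((4,7,6),0,9),
      ((0,9,1),1,9), ((0,9,6),1,6), ((4,7,9),4,9), ((5,2,7),7,3), ((0,2,3),5,3)]"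

lemma two_cops_win_on_pattern_B: "two_cops_win_on pattern_B"
proof (rule two_cops_win_on_if_winning_table[where T = pattern_B_table and a = 0 and b = 2])
  show "winning_table pattern_B pattern_B_table" by code_simp
  show "\<forall>x\<in>set [0..<10]. x = 0 \<or> x = 2 \<or> (0, 2, x) \<in> fst ` set pattern_B_table"
    by code_simp
qed simp_all

section \<open>From two patterns to all strong orientations\<close>

definition five_cycle :: "(nat \<times> nat) list" where
  "five_cycle = [(0,1), (1,2), (2,3), (3,4), (4,0)]"

text \<open>Indices 0 and 1 mean \<open>pattern_A\<close> and \<open>pattern_B\<close>. Their images
  may sit on a directed 5-cycle other than the given one. The cuts are single vertices, or the given
  cycle when all spokes point the same way.\<close>

definition five_cycle_cases :: case_tree where
  "five_cycle_cases =
    (Split 5 7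
      (Split 7 9
       (Split 6 8
        (Split 0 5
         (Split 3 8
          (Split 8 5
           (Split 1 6
            (Split 4 9
             (Split 2 7
              (Cut [0, 1, 2, 3, 4])
              (Split 9 6
               (Image 1 [3, 8, 5, 7, 2, 4, 6, 0, 9, 1])
               (Cut [9])))
             (Image 1 [0, 5, 7, 9, 4, 1, 8, 2, 6, 3]))
            (Split 9 6
             (Split 2 7
              (Image 1 [2, 7, 9, 6, 1, 3, 5, 4, 8, 0])
              (Split 4 9
               (Image 0 [3, 8, 5, 7, 2, 4, 6, 0, 9, 1])
               (Image 1 [7, 2, 3, 8, 5, 9, 1, 4, 6, 0])))
             (Cut [6])))
           (Cut [8]))
          (Split 4 9
           (Split 9 6
            (Split 2 7
             (Image 1 [4, 9, 6, 8, 3, 0, 7, 1, 5, 2])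
             (Image 0 [4, 9, 6, 8, 3, 0, 7, 1, 5, 2]))
            (Cut [9]))
           (Split 1 6
            (Image 0 [0, 5, 7, 9, 4, 1, 8, 2, 6, 3])
            (Split 9 6
             (Image 1 [9, 4, 0, 5, 7, 6, 3, 1, 8, 2])
             (Cut [6])))))
         (Split 8 5
          (Split 1 6
           (Split 4 9
            (Split 9 6
             (Split 2 7
              (Image 1 [1, 6, 8, 5, 0, 2, 9, 3, 7, 4])
              (Split 3 8
               (Image 1 [3, 8, 5, 7, 2, 4, 6, 0, 9, 1])
               (Image 1 [8, 3, 4, 9, 6, 5, 2, 0, 7, 1])))
             (Cut [9]))
            (Split 2 7
             (Image 0 [1, 6, 8, 5, 0, 2, 9, 3, 7, 4])
             (Image 1 [5, 0, 1, 6, 8, 7, 4, 2, 9, 3])))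
           (Split 9 6
            (Split 2 7
             (Split 3 8
              (Image 0 [2, 7, 9, 6, 1, 3, 5, 4, 8, 0])
              (Image 1 [6, 1, 2, 7, 9, 8, 0, 3, 5, 4]))
             (Split 3 8
              (Split 4 9
               (Image 0 [3, 8, 5, 7, 2, 4, 6, 0, 9, 1])
               (Image 1 [7, 2, 3, 8, 5, 9, 1, 4, 6, 0]))
              (Split 4 9
               (Image 1 [8, 3, 4, 9, 6, 5, 2, 0, 7, 1])
               (Cut [0, 1, 2, 3, 4]))))
            (Cut [6])))
          (Cut [5])))
        (Split 8 5
         (Split 3 8
          (Split 9 6
           (Split 1 6
            (Cut [6])
            (Split 2 7
             (Split 0 5
              (Image 1 [2, 7, 9, 6, 1, 3, 5, 4, 8, 0])
              (Image 0 [2, 7, 9, 6, 1, 3, 5, 4, 8, 0]))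
             (Split 4 9
              (Image 0 [3, 8, 5, 7, 2, 4, 6, 0, 9, 1])
              (Image 1 [7, 2, 3, 8, 5, 9, 1, 4, 6, 0]))))
           (Split 4 9
            (Cut [9])
            (Image 1 [3, 4, 0, 1, 2, 8, 9, 5, 6, 7])))
          (Cut [8]))
         (Split 0 5
          (Split 9 6
           (Split 1 6
            (Cut [6])
            (Image 1 [0, 1, 2, 3, 4, 5, 6, 7, 8, 9]))
           (Split 4 9
            (Cut [9])
            (Image 0 [0, 1, 2, 3, 4, 5, 6, 7, 8, 9])))
          (Cut [5]))))
       (Split 2 7
        (Cut [7])
        (Split 8 5
         (Split 9 6
          (Split 4 9
           (Split 3 8
            (Split 1 6
             (Split 6 8
              (Image 1 [3, 8, 5, 7, 2, 4, 6, 0, 9, 1])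
              (Cut [6]))
             (Image 0 [3, 8, 5, 7, 2, 4, 6, 0, 9, 1]))
            (Split 6 8
             (Split 0 5
              (Image 0 [4, 9, 6, 8, 3, 0, 7, 1, 5, 2])
              (Image 1 [8, 3, 4, 9, 6, 5, 2, 0, 7, 1]))
             (Cut [8])))
           (Cut [9]))
          (Split 6 8
           (Split 1 6
            (Image 1 [1, 2, 3, 4, 0, 6, 7, 8, 9, 5])
            (Cut [6]))
           (Split 3 8
            (Image 0 [3, 4, 0, 1, 2, 8, 9, 5, 6, 7])
            (Cut [8]))))
         (Split 0 5
          (Split 3 8
           (Split 6 8
            (Cut [8])
            (Split 1 6
             (Split 9 6
              (Cut [6])
              (Image 0 [3, 4, 0, 1, 2, 8, 9, 5, 6, 7]))
             (Image 0 [3, 8, 6, 1, 2, 4, 5, 9, 0, 7])))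
           (Split 1 6
            (Split 4 9
             (Split 6 8
              (Image 0 [4, 9, 7, 2, 3, 0, 6, 5, 1, 8])
              (Split 9 6
               (Cut [6])
               (Image 1 [4, 9, 7, 2, 3, 0, 6, 5, 1, 8])))
             (Split 9 6
              (Cut [9])
              (Image 0 [0, 1, 6, 9, 4, 5, 2, 8, 7, 3])))
            (Split 9 6
             (Split 4 9
              (Image 0 [4, 0, 5, 8, 3, 9, 1, 7, 6, 2])
              (Cut [9]))
             (Split 6 8
              (Cut [6])
              (Image 1 [8, 3, 4, 0, 5, 6, 2, 9, 1, 7])))))
          (Cut [5])))))
      (Split 7 9
       (Split 2 7
        (Split 9 6
         (Split 8 5
          (Split 0 5
           (Cut [5])
           (Split 1 6
            (Split 6 8
             (Split 4 9
              (Image 1 [1, 6, 8, 5, 0, 2, 9, 3, 7, 4])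
              (Image 0 [1, 6, 8, 5, 0, 2, 9, 3, 7, 4]))
             (Cut [6]))
            (Split 3 8
             (Image 0 [2, 7, 9, 6, 1, 3, 5, 4, 8, 0])
             (Split 6 8
              (Image 1 [6, 1, 2, 7, 9, 8, 0, 3, 5, 4])
              (Cut [8])))))
          (Split 6 8
           (Split 3 8
            (Cut [8])
            (Image 1 [2, 3, 4, 0, 1, 7, 8, 9, 5, 6]))
           (Split 1 6
            (Cut [6])
            (Image 0 [2, 3, 4, 0, 1, 7, 8, 9, 5, 6]))))
         (Split 4 9
          (Cut [9])
          (Split 0 5
           (Split 8 5
            (Cut [5])
            (Split 3 8
             (Split 6 8
              (Cut [8])
              (Image 0 [0, 1, 2, 3, 4, 5, 6, 7, 8, 9]))
             (Image 0 [0, 5, 8, 3, 4, 1, 7, 6, 2, 9])))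
           (Split 3 8
            (Split 1 6
             (Split 8 5
              (Image 0 [1, 6, 9, 4, 0, 2, 8, 7, 3, 5])
              (Split 6 8
               (Cut [8])
               (Image 1 [1, 6, 9, 4, 0, 2, 8, 7, 3, 5])))
             (Split 6 8
              (Cut [6])
              (Image 0 [2, 3, 8, 6, 1, 7, 4, 5, 9, 0])))
            (Split 6 8
             (Split 1 6
              (Image 0 [1, 2, 7, 5, 0, 6, 3, 9, 8, 4])
              (Cut [6]))
             (Split 8 5
              (Cut [8])
              (Image 1 [5, 0, 1, 2, 7, 8, 4, 6, 3, 9])))))))
        (Cut [7]))
       (Split 4 9
        (Split 6 8
         (Split 8 5
          (Split 0 5
           (Cut [5])
           (Split 9 6
            (Image 1 [4, 0, 1, 2, 3, 9, 5, 6, 7, 8])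
            (Split 1 6
             (Image 0 [1, 2, 3, 4, 0, 6, 7, 8, 9, 5])
             (Cut [6]))))
          (Split 3 8
           (Cut [8])
           (Image 0 [4, 0, 1, 2, 3, 9, 5, 6, 7, 8])))
         (Split 0 5
          (Split 8 5
           (Cut [5])
           (Split 1 6
            (Split 9 6
             (Cut [6])
             (Split 2 7
              (Split 3 8
               (Cut [0, 1, 2, 3, 4])
               (Image 1 [0, 5, 8, 3, 4, 1, 7, 6, 2, 9]))
              (Image 1 [4, 9, 7, 2, 3, 0, 6, 5, 1, 8])))
            (Split 3 8
             (Image 1 [3, 8, 6, 1, 2, 4, 5, 9, 0, 7])
             (Split 2 7
              (Image 0 [8, 3, 4, 0, 5, 6, 2, 9, 1, 7])
              (Split 9 6
               (Image 0 [4, 0, 5, 8, 3, 9, 1, 7, 6, 2])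
               (Image 1 [8, 3, 4, 0, 5, 6, 2, 9, 1, 7]))))))
          (Split 2 7
           (Split 9 6
            (Split 1 6
             (Cut [6])
             (Image 0 [2, 7, 5, 0, 1, 3, 9, 8, 4, 6]))
            (Split 3 8
             (Image 1 [2, 7, 5, 0, 1, 3, 9, 8, 4, 6])
             (Split 8 5
              (Cut [8])
              (Image 0 [5, 0, 1, 2, 7, 8, 4, 6, 3, 9]))))
           (Split 1 6
            (Split 9 6
             (Cut [6])
             (Image 0 [7, 2, 3, 4, 9, 5, 1, 8, 0, 6]))
            (Split 8 5
             (Split 3 8
              (Image 0 [3, 4, 9, 7, 2, 8, 0, 6, 5, 1])
              (Cut [8]))
             (Image 1 [7, 2, 3, 4, 9, 5, 1, 8, 0, 6]))))))
        (Split 9 6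
         (Cut [9])
         (Split 1 6
          (Split 8 5
           (Split 0 5
            (Cut [5])
            (Image 0 [1, 2, 3, 4, 0, 6, 7, 8, 9, 5]))
           (Split 3 8
            (Split 6 8
             (Cut [8])
             (Split 2 7
              (Image 1 [1, 6, 9, 4, 0, 2, 8, 7, 3, 5])
              (Image 0 [9, 4, 0, 1, 6, 7, 3, 5, 2, 8])))
            (Split 2 7
             (Split 0 5
              (Image 1 [0, 5, 8, 3, 4, 1, 7, 6, 2, 9])
              (Split 6 8
               (Image 0 [1, 2, 7, 5, 0, 6, 3, 9, 8, 4])
               (Image 1 [5, 0, 1, 2, 7, 8, 4, 6, 3, 9])))
             (Image 1 [9, 4, 0, 1, 6, 7, 3, 5, 2, 8]))))
          (Split 6 8
           (Cut [6])
           (Split 0 5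
            (Split 8 5
             (Cut [5])
             (Split 3 8
              (Image 0 [6, 1, 2, 3, 8, 9, 0, 7, 4, 5])
              (Split 2 7
               (Image 0 [8, 3, 4, 0, 5, 6, 2, 9, 1, 7])
               (Image 1 [8, 3, 4, 0, 5, 6, 2, 9, 1, 7]))))
            (Split 3 8
             (Image 1 [6, 1, 2, 3, 8, 9, 0, 7, 4, 5])
             (Split 2 7
              (Split 8 5
               (Cut [8])
               (Image 1 [5, 0, 1, 2, 7, 8, 4, 6, 3, 9]))
              (Cut [0, 1, 2, 3, 4]))))))))))"

lemma two_cops_win_on_five_cycle: "two_cops_win_on five_cycle"
proof (rule two_cops_win_on_if_covers)
  show "\<forall>L\<in>set [pattern_A, pattern_B]. two_cops_win_on L"
    using two_cops_win_on_pattern_A two_cops_win_on_pattern_B by simp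
  show "covers [pattern_A, pattern_B] five_cycle five_cycle_cases" by code_simp
qed

definition path :: "(nat \<times> nat) list" where
  "path = [(0,1), (1,2), (2,3)]"

text \<open>The first five entries of each image list form the directed 5-cycle that was found. Cuts
  of one or two vertices suffice.\<close>

definition path_cases :: case_tree where
  "path_cases =
    (Split 4 9
      (Split 4 0
       (Split 3 4
        (Image 0 [0, 1, 2, 3, 4, 5, 6, 7, 8, 9])
        (Cut [4]))
       (Split 0 5
        (Cut [0])
        (Split 5 7
         (Split 8 5
          (Split 3 4
           (Split 7 9
            (Split 6 8
             (Split 9 6
              (Image 0 [5, 7, 9, 6, 8, 0, 2, 4, 1, 3])
              (Cut [9]))
             (Split 1 6
              (Cut [6, 9])
              (Split 3 8
               (Image 0 [1, 2, 3, 8, 6, 0, 7, 4, 5, 9])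
               (Cut [8]))))
            (Split 2 7
             (Cut [7])
             (Image 0 [2, 3, 4, 9, 7, 1, 8, 0, 6, 5])))
           (Split 3 8
            (Image 0 [0, 4, 3, 8, 5, 1, 9, 2, 6, 7])
            (Cut [3])))
          (Cut [5]))
         (Split 2 7
          (Image 0 [0, 1, 2, 7, 5, 4, 6, 3, 9, 8])
          (Split 7 9
           (Cut [7])
           (Image 0 [0, 4, 9, 7, 5, 1, 3, 6, 2, 8]))))))
      (Split 3 4
       (Split 4 0
        (Image 0 [0, 1, 2, 3, 4, 5, 6, 7, 8, 9])
        (Cut [4]))
       (Split 3 8
        (Split 6 8
         (Split 8 5
          (Split 4 0
           (Split 9 6
            (Split 5 7
             (Split 7 9
              (Image 0 [5, 7, 9, 6, 8, 0, 2, 4, 1, 3])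
              (Cut [9]))
             (Split 0 5
              (Cut [5])
              (Split 2 7
               (Image 0 [0, 1, 2, 7, 5, 4, 6, 3, 9, 8])
               (Cut [7, 9]))))
            (Split 1 6
             (Image 0 [0, 1, 6, 9, 4, 5, 2, 8, 7, 3])
             (Cut [6])))
           (Split 0 5
            (Cut [0])
            (Image 0 [0, 4, 3, 8, 5, 1, 9, 2, 6, 7])))
          (Cut [8]))
         (Split 1 6
          (Split 9 6
           (Cut [6])
           (Image 0 [3, 8, 6, 9, 4, 2, 5, 1, 7, 0]))
          (Image 0 [1, 2, 3, 8, 6, 0, 7, 4, 5, 9])))
        (Cut [3]))))"

lemma two_cops_win_on_path: "two_cops_win_on path"
proof (rule two_cops_win_on_if_covers)
  show "\<forall>L\<in>set [five_cycle]. two_cops_win_on L"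
    using two_cops_win_on_five_cycle by simp
  show "covers [five_cycle] path path_cases" by code_simp
qed

text \<open>The edge between 1 and 2 is always the middle of a directed path of length 3: its tail
  has an arc in and its head an arc out, since a strong orientation has no source or sink.\<close>

definition initial_cases :: case_tree where
  "initial_cases =
    (Split 0 1
      (Split 1 2
       (Split 2 3
        (Image 0 [0, 1, 2, 3, 4, 5, 6, 7, 8, 9])
        (Split 2 7
         (Image 0 [0, 1, 2, 7, 5, 4, 6, 3, 9, 8])
         (Cut [2])))
       (Split 1 6
        (Split 2 3
         (Split 2 7
          (Cut [2])
          (Image 0 [7, 2, 1, 6, 9, 5, 3, 0, 8, 4]))
         (Image 0 [3, 2, 1, 6, 8, 4, 7, 0, 9, 5]))
        (Cut [1])))
      (Split 1 2
       (Split 1 6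
        (Cut [1])
        (Split 2 3
         (Image 0 [6, 1, 2, 3, 8, 9, 0, 7, 4, 5])
         (Split 2 7
          (Image 0 [6, 1, 2, 7, 9, 8, 0, 3, 5, 4])
          (Cut [2]))))
       (Split 2 3
        (Split 2 7
         (Cut [2])
         (Image 0 [7, 2, 1, 0, 5, 9, 3, 6, 4, 8]))
        (Image 0 [3, 2, 1, 0, 4, 8, 7, 6, 5, 9]))))"

lemma two_cops_win_on_Nil: "two_cops_win_on []"
proof (rule two_cops_win_on_if_covers)
  show "\<forall>L\<in>set [path]. two_cops_win_on L"
    using two_cops_win_on_path by simp
  show "covers [path] [] initial_cases" by code_simp
qed

section \<open>Comparison of the cop numbers\<close>

lemma cops_win_2_if_strong_orientation_of_petersen:
  assumes "orientation_of D petersen" "strongly_connected (with_proj D)"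
  shows "cops_win (with_proj D) 2"
  using two_cops_win_on_Nil automorphism_id assms unfolding two_cops_win_on_def by fastforce

lemma cop_number_petersen: "2 < cop_number (with_proj petersen)"
proof -
  interpret pair_graph petersen by (rule pair_graph_petersen)
  have "cops_win (with_proj petersen) 10"
    using cops_win_card_verts[of "with_proj petersen"] wf_digraph_axioms by simp
  then have "cops_win (with_proj petersen) (cop_number (with_proj petersen))"
    unfolding cop_number_def by (rule LeastI)
  then show ?thesis using not_cops_win_petersen not_le_imp_less by blast
qed

theorem corollary9:
  shows "\<exists>G :: nat pair_pre_digraph. pair_graph G \<and>
    (\<exists>D. orientation_of D G \<and> strongly_connected (with_proj D)) \<and>
    (\<forall>D. orientation_of D G \<and> strongly_connected (with_proj D) \<longrightarrow>
      cop_number (with_proj D) < cop_number (with_proj G))"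
proof (rule exI[of _ petersen], intro conjI allI impI)
  show "pair_graph petersen" by (rule pair_graph_petersen)
  show "\<exists>D. orientation_of D petersen \<and> strongly_connected (with_proj D)"
    using orientation_of_petersen_strong_orientation
      strongly_connected_petersen_strong_orientation by blast
next
  fix D assume "orientation_of D petersen \<and> strongly_connected (with_proj D)"
  then have "cops_win (with_proj D) 2"
    using cops_win_2_if_strong_orientation_of_petersen by blast
  then have "cop_number (with_proj D) \<le> 2"
    unfolding cop_number_def by (rule Least_le)
  then show "cop_number (with_proj D) < cop_number (with_proj petersen)"
    using cop_number_petersen by simp
qed

end
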